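(* Let $T$ be a tree with $n$ vertices, and let $q\ge 2$ be an integer. Then $s_q(T)=nq-q+1$.
   Context: Graphs are finite and simple. $\mathbb{Z}_q$ denotes the cyclic group of order $q$. A $\mathbb{Z}_q$-edge-weighted $K_f$ is the complete graph $K_f$ on $f$ vertices equipped with a weight function $\omega:E(K_f)\to\mathbb{Z}_q$ (arbitrary). The weight of a path is the sum in $\mathbb{Z}_q$ of the weights of its edges. A subdivision of a graph $H$ is a graph obtained from $H$ by replacing each edge of $H$ by a path (a subdivision path) of length at least $1$ with the same endpoints, where the internal vertices of these paths are new and the paths are pairwise internally disjoint. A $q$-divisible subdivision of $H$ in a $\mathbb{Z}_q$-edge-weighted $K_f$ is a subgraph of $K_f$ that is a subdivision of $H$ in which every subdivision path has weight $0$ in $\mathbb{Z}_q$. For an integer $q\ge 2$, $s_q(H)$ denotes the minimum $f$ such that every $\mathbb{Z}_q$-edge-weighted $K_f$ contains a $q$-divisible subdivision of $H$. *)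

theory Defs
  imports "HOL-Library.Extended_Nat" "HOL-Library.FuncSet"
begin

record 'a ugraph =
  gverts :: "'a set"
  gedges :: "'a set set"

definition simple_graph :: "'a ugraph \<Rightarrow> bool" where
  "simple_graph G \<longleftrightarrow>
     finite (gverts G) \<and> (\<forall>e\<in>gedges G. e \<subseteq> gverts G \<and> card e = 2)"

definition subgraph :: "'a ugraph \<Rightarrow> 'a ugraph \<Rightarrow> bool" where
  "subgraph S G \<longleftrightarrow>
     simple_graph S \<and> gverts S \<subseteq> gverts G \<and> gedges S \<subseteq> gedges G"

definition complete_graph :: "nat \<Rightarrow> nat ugraph" where
  "complete_graph f = \<lparr>gverts = {..<f}, gedges = {e. e \<subseteq> {..<f} \<and> card e = 2}\<rparr>"

text \<open>A path is given by the list of its vertices, so its length is one less than the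
  length of the list.\<close>

fun path_edges :: "'a list \<Rightarrow> 'a set list" where
  "path_edges (u # v # p) = {u, v} # path_edges (v # p)"
| "path_edges _ = []"

definition is_path :: "'a ugraph \<Rightarrow> 'a list \<Rightarrow> bool" where
  "is_path G p \<longleftrightarrow>
     p \<noteq> [] \<and> distinct p \<and> set p \<subseteq> gverts G \<and> set (path_edges p) \<subseteq> gedges G"

definition internal_verts :: "'a list \<Rightarrow> 'a set" where
  "internal_verts p = set (butlast (tl p))"

definition connected_graph :: "'a ugraph \<Rightarrow> bool" where
  "connected_graph G \<longleftrightarrow> gverts G \<noteq> {} \<and>
     (\<forall>u\<in>gverts G. \<forall>v\<in>gverts G. \<exists>p. is_path G p \<and> hd p = u \<and> last p = v)"

text \<open>A cycle is a path on at least three vertices closed up by an edge between its ends.\<close>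

definition acyclic_graph :: "'a ugraph \<Rightarrow> bool" where
  "acyclic_graph G \<longleftrightarrow>
     \<not> (\<exists>p. is_path G p \<and> length p \<ge> 3 \<and> {last p, hd p} \<in> gedges G)"

definition tree :: "'a ugraph \<Rightarrow> bool" where
  "tree G \<longleftrightarrow> simple_graph G \<and> connected_graph G \<and> acyclic_graph G"

text \<open>The graph \<open>S\<close> is a subdivision of \<open>H\<close>: the map \<open>\<phi>\<close> sends the vertices of \<open>H\<close> to the
  corresponding (branch) vertices of \<open>S\<close>, and \<open>P e\<close> is the subdivision path replacing the
  edge \<open>e\<close>, listed in either direction.\<close>

definition subdivision_via ::
  "'a ugraph \<Rightarrow> 'b ugraph \<Rightarrow> ('a \<Rightarrow> 'b) \<Rightarrow> ('a set \<Rightarrow> 'b list) \<Rightarrow> bool" where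
  "subdivision_via H S \<phi> P \<longleftrightarrow>
     inj_on \<phi> (gverts H) \<and>
     (\<forall>e\<in>gedges H. is_path S (P e) \<and> length (P e) \<ge> 2 \<and>
        {hd (P e), last (P e)} = \<phi> ` e \<and>
        internal_verts (P e) \<inter> \<phi> ` gverts H = {}) \<and>
     (\<forall>e\<in>gedges H. \<forall>e'\<in>gedges H. e \<noteq> e' \<longrightarrow>
        internal_verts (P e) \<inter> internal_verts (P e') = {}) \<and>
     gverts S = \<phi> ` gverts H \<union> (\<Union>e\<in>gedges H. internal_verts (P e)) \<and>
     gedges S = (\<Union>e\<in>gedges H. set (path_edges (P e)))"

text \<open>The cyclic group of order \<open>q\<close> is represented by the residues \<open>{0..<int q}\<close> with
  addition modulo \<open>q\<close>.\<close>

definition Zq_weighting :: "nat \<Rightarrow> 'a ugraph \<Rightarrow> ('a set \<Rightarrow> int) \<Rightarrow> bool" where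
  "Zq_weighting q G \<omega> \<longleftrightarrow> \<omega> \<in> gedges G \<rightarrow> {0..<int q}"

definition path_weight :: "nat \<Rightarrow> ('a set \<Rightarrow> int) \<Rightarrow> 'a list \<Rightarrow> int" where
  "path_weight q \<omega> p = (\<Sum>e\<leftarrow>path_edges p. \<omega> e) mod int q"

definition has_divisible_subdivision ::
  "nat \<Rightarrow> 'a ugraph \<Rightarrow> 'b ugraph \<Rightarrow> ('b set \<Rightarrow> int) \<Rightarrow> bool" where
  "has_divisible_subdivision q H G \<omega> \<longleftrightarrow>
     (\<exists>S \<phi> P. subgraph S G \<and> subdivision_via H S \<phi> P \<and>
        (\<forall>e\<in>gedges H. path_weight q \<omega> (P e) = 0))"

text \<open>The infimum is taken in \<^typ>\<open>enat\<close>, so that a finite value \<open>enat m\<close> says that the set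
  is nonempty with minimum \<open>m\<close>; the infimum of the empty set is \<open>\<infinity>\<close>.\<close>

definition s_number :: "nat \<Rightarrow> 'a ugraph \<Rightarrow> enat" where
  "s_number q H = Inf (enat ` {f. \<forall>\<omega>. Zq_weighting q (complete_graph f) \<omega> \<longrightarrow>
     has_divisible_subdivision q H (complete_graph f) \<omega>})"

end

theory Submission
  imports Defs
begin

text \<open>
  Upper bound. The tree is built leaf by leaf, each new leaf costing \<open>q\<close> further host
  vertices. The difficulty is that a single embedding of the smaller tree \<open>T\<close> need not
  extend: its branch vertex \<open>\<phi> u\<close>, where the leaf has to be attached, may have no zero-weight
  path into the unused vertices at all. So many embeddings are considered at once. Let \<open>x\<^sub>0\<close>
  be the image of \<open>u\<close> in some embedding into \<open>V\<close>, let \<open>x\<^sub>1\<close> be its image in some embedding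
  into \<open>V - {x\<^sub>0}\<close>, and so on up to \<open>x\<^sub>q\<close>; each embedding avoids all earlier \<open>x\<close>'s, and
  only \<open>q\<close> vertices have been discarded by the last step (\<open>exists_greedy_sequence\<close>).
  Among the \<open>q + 1\<close> initial weights of the path \<open>x\<^sub>0 \<dots> x\<^sub>q\<close> two agree, so that a segment
  \<open>x\<^sub>i \<dots> x\<^sub>j\<close> with \<open>i < j\<close> has weight \<open>0\<close> (\<open>zero_weight_segment\<close>). The embedding that has
  \<open>u\<close> at \<open>x\<^sub>j\<close> meets this segment in \<open>x\<^sub>j\<close> only, and so the segment is the missing
  subdivision path and \<open>x\<^sub>i\<close> the image of the new leaf (\<open>tree_has_divisible_embedding\<close>).

  Lower bound. If every edge has weight \<open>1\<close>, each of the \<open>n - 1\<close> subdivision paths has a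
  positive length divisible by \<open>q\<close>, hence at least \<open>q - 1\<close> internal vertices, which gives
  \<open>n + (n - 1) (q - 1) = n q - q + 1\<close> vertices (\<open>unit_weight_subdivision_card\<close>).
\<close>

section \<open>Trees are built by adding leaves\<close>

lemma path_edges_append:
  "path_edges (xs @ y # ys) = path_edges (xs @ [y]) @ path_edges (y # ys)"
proof (induction xs)
  case (Cons x xs)
  then show ?case by (cases xs) auto
qed simp

lemma length_path_edges: "length (path_edges p) = length p - 1"
  by (induction p rule: path_edges.induct) auto

lemma path_edges_distinct:
  "distinct p \<Longrightarrow> e \<in> set (path_edges p) \<Longrightarrow> e \<subseteq> set p \<and> card e = 2"
  by (induction p rule: path_edges.induct) auto

lemma is_path_Cons_Cons:
  "is_path G (u # v # p) \<longleftrightarrow>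
     u \<in> gverts G \<and> u \<notin> set (v # p) \<and> {u, v} \<in> gedges G \<and> is_path G (v # p)"
  unfolding is_path_def by auto

lemma is_path_prefix: "is_path G (xs @ y # ys) \<Longrightarrow> is_path G (xs @ [y])"
  unfolding is_path_def path_edges_append[of xs y ys] by auto

text \<open>The leaf is an end of a longest path: a neighbour of that end off the path would
  extend the path, and a second neighbour on the path would close a cycle.\<close>

lemma tree_card_2_has_leaf:
  assumes T: "tree T" and two: "card (gverts T) \<ge> 2"
  obtains l u where "l \<in> gverts T" "u \<in> gverts T" "u \<noteq> l" "{u, l} \<in> gedges T"
    "\<And>e. e \<in> gedges T \<Longrightarrow> l \<in> e \<Longrightarrow> e = {u, l}"
proof -
  have fin: "finite (gverts T)"
    and simple: "\<And>e. e \<in> gedges T \<Longrightarrow> e \<subseteq> gverts T \<and> card e = 2"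
    and conn: "\<And>u v. u \<in> gverts T \<Longrightarrow> v \<in> gverts T \<Longrightarrow>
      \<exists>p. is_path T p \<and> hd p = u \<and> last p = v"
    and acyc: "\<And>p. is_path T p \<Longrightarrow> length p \<ge> 3 \<Longrightarrow> {last p, hd p} \<notin> gedges T"
    using T unfolding tree_def simple_graph_def connected_graph_def acyclic_graph_def by auto
  obtain a b where ab: "a \<in> gverts T" "b \<in> gverts T" "a \<noteq> b"
    using two fin by (metis card_le_Suc0_iff_eq not_less_eq_eq numeral_2_eq_2)
  obtain p0 where p0: "is_path T p0" "hd p0 = a" "last p0 = b" using conn ab by blast
  have bound: "length p \<le> card (gverts T)" if "is_path T p" for p
    using that fin unfolding is_path_def by (metis card_mono distinct_card)
  obtain p where p: "is_path T p" and longest: "\<And>p'. is_path T p' \<Longrightarrow> length p' \<le> length p"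
    using ex_has_greatest_nat[of "is_path T" p0 length "Suc (card (gverts T))"] p0 bound
    by (metis le_imp_less_Suc)
  have "length p0 \<ge> 2"
    using p0 ab unfolding is_path_def by (cases p0 rule: path_edges.cases) auto
  then have "length p \<ge> 2" using longest[OF p0(1)] by simp
  then obtain l u r where p_eq: "p = l # u # r" by (cases p rule: path_edges.cases) auto
  have lu: "l \<in> gverts T" "u \<in> gverts T" "u \<noteq> l" "{u, l} \<in> gedges T"
    using p unfolding p_eq is_path_def by (auto simp: insert_commute)
  have "e = {u, l}" if e: "e \<in> gedges T" "l \<in> e" for e
  proof -
    obtain w where w: "e = {l, w}" "w \<noteq> l" "w \<in> gverts T"
      using simple[OF e(1)] e(2) unfolding card_2_iff by auto
    show ?thesis
    proof (cases "w \<in> set p")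
      case False
      then have "is_path T (w # p)"
        using p w e unfolding p_eq is_path_Cons_Cons by (auto simp: insert_commute)
      then show ?thesis using longest[of "w # p"] by simp
    next
      case True
      have "w = u"
      proof (rule ccontr)
        assume "w \<noteq> u"
        then obtain r1 r2 where "r = r1 @ w # r2"
          using True w p_eq by (auto dest: split_list)
        then have "is_path T ((l # u # r1) @ [w])"
          using p is_path_prefix[of T "l # u # r1" w r2] p_eq by simp
        from acyc[OF this] show False using e w by (simp add: insert_commute)
      qed
      then show ?thesis using w by auto
    qed
  qed
  then show thesis using that[OF lu] by blast
qed

lemma tree_delete_leaf:
  assumes T: "tree T" and lu: "u \<in> gverts T" "u \<noteq> l"
    and leaf: "\<And>e. e \<in> gedges T \<Longrightarrow> l \<in> e \<Longrightarrow> e = {u, l}"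
  shows "tree \<lparr>gverts = gverts T - {l}, gedges = gedges T - {{u, l}}\<rparr>" (is "tree ?T'")
proof -
  have conn: "\<And>u v. u \<in> gverts T \<Longrightarrow> v \<in> gverts T \<Longrightarrow>
      \<exists>p. is_path T p \<and> hd p = u \<and> last p = v"
    and acyc: "\<not> (\<exists>p. is_path T p \<and> length p \<ge> 3 \<and> {last p, hd p} \<in> gedges T)"
    using T unfolding tree_def connected_graph_def acyclic_graph_def by auto
  have "simple_graph ?T'"
    using T leaf unfolding tree_def simple_graph_def by auto
  moreover have "connected_graph ?T'"
    unfolding connected_graph_def
  proof (intro conjI ballI)
    show "gverts ?T' \<noteq> {}" using lu by auto
  next
    fix a b assume ab: "a \<in> gverts ?T'" "b \<in> gverts ?T'"
    then obtain p where p: "is_path T p" "hd p = a" "last p = b" using conn[of a b] by auto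
    have "l \<notin> set p"
    proof
      assume "l \<in> set p"
      then obtain xs ys where eq: "p = xs @ l # ys" by (auto dest: split_list)
      \<comment> \<open>Inside a path, \<open>l\<close> would need two distinct neighbours.\<close>
      obtain xs' x where xs: "xs = xs' @ [x]" using eq p(2) ab by (cases xs rule: rev_cases) auto
      obtain y ys' where ys: "ys = y # ys'" using eq p(3) ab by (cases ys) auto
      have "set (path_edges p) \<subseteq> gedges T" "distinct p" using p unfolding is_path_def by auto
      moreover have "path_edges p = path_edges (xs' @ [x]) @ {x, l} # {l, y} # path_edges (y # ys')"
        using path_edges_append[of xs' x "l # y # ys'"] by (simp add: eq xs ys)
      ultimately have "{x, l} = {u, l}" "{l, y} = {u, l}" "x \<noteq> y" "x \<noteq> l" "y \<noteq> l"
        using leaf[of "{x, l}"] leaf[of "{l, y}"] by (auto simp: eq xs ys)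
      then show False by (auto simp: doubleton_eq_iff)
    qed
    moreover from this have "{u, l} \<notin> set (path_edges p)"
      using path_edges_distinct[of p "{u, l}"] p unfolding is_path_def by auto
    ultimately have "is_path ?T' p" using p unfolding is_path_def by auto
    then show "\<exists>p. is_path ?T' p \<and> hd p = a \<and> last p = b" using p by blast
  qed
  moreover have "acyclic_graph ?T'"
    using acyc unfolding acyclic_graph_def is_path_def by auto
  ultimately show ?thesis unfolding tree_def by blast
qed

text \<open>Every tree arises from a single vertex by repeatedly attaching leaves. This is the only
  form in which acyclicity and connectedness enter the rest of the proof.\<close>

lemma tree_induct [consumes 1, case_names single leaf]:
  assumes "tree T"
    and single: "\<And>v. R \<lparr>gverts = {v}, gedges = {}\<rparr>"
    and leaf: "\<And>T u l. \<lbrakk>tree T; R T; u \<in> gverts T; l \<notin> gverts T\<rbrakk> \<Longrightarrow>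
      R \<lparr>gverts = insert l (gverts T), gedges = insert {u, l} (gedges T)\<rparr>"
  shows "R T"
  using \<open>tree T\<close>
proof (induction "card (gverts T)" arbitrary: T rule: less_induct)
  case less
  have fin: "finite (gverts T)" and ne: "gverts T \<noteq> {}"
    and simple: "\<And>e. e \<in> gedges T \<Longrightarrow> e \<subseteq> gverts T \<and> card e = 2"
    using less.prems unfolding tree_def simple_graph_def connected_graph_def by auto
  show ?case
  proof (cases "card (gverts T) \<ge> 2")
    case True
    from tree_card_2_has_leaf[OF less.prems True] obtain l u
      where lu: "l \<in> gverts T" "u \<in> gverts T" "u \<noteq> l" "{u, l} \<in> gedges T"
        and l: "\<And>e. e \<in> gedges T \<Longrightarrow> l \<in> e \<Longrightarrow> e = {u, l}" by metis
    define T' where "T' = \<lparr>gverts = gverts T - {l}, gedges = gedges T - {{u, l}}\<rparr>"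
    have T': "tree T'" unfolding T'_def by (rule tree_delete_leaf[OF less.prems lu(2,3) l])
    have "card (gverts T') < card (gverts T)"
      using lu(1) fin unfolding T'_def by (simp only: ugraph.simps card_Diff1_less)
    then have "R T'" using less.hyps T' by blast
    moreover have "T = \<lparr>gverts = insert l (gverts T'), gedges = insert {u, l} (gedges T')\<rparr>"
      using lu unfolding T'_def by (simp add: insert_absorb)
    ultimately show ?thesis using leaf[OF T', of u l] lu unfolding T'_def by simp
  next
    case False
    then have "card (gverts T) = 1" using fin ne
      by (metis One_nat_def Suc_1 card_gt_0_iff less_Suc_eq_le linorder_not_le le_antisym Suc_leI)
    then obtain v where v: "gverts T = {v}" by (auto simp: card_1_singleton_iff)
    have "gedges T = {}"
    proof (rule equals0I)
      fix e assume "e \<in> gedges T"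
      then have "card e = 2" "e \<subseteq> {v}" using simple v by auto
      then show False using card_mono[of "{v}" e] by simp
    qed
    then show ?thesis using single[of v] v by (metis (full_types) old.unit.exhaust ugraph.surjective)
  qed
qed

lemma tree_finite_edges_card:
  assumes "tree T"
  shows "finite (gedges T) \<and> card (gverts T) = card (gedges T) + 1"
  using assms
proof (induction rule: tree_induct)
  case (leaf T u l)
  have "finite (gverts T)" "{u, l} \<notin> gedges T"
    using leaf.hyps unfolding tree_def simple_graph_def by blast+
  then show ?case using leaf by simp
qed simp

section \<open>Subdivisions inside a vertex set\<close>

text \<open>The subgraph that carries a subdivision is determined by the branch map and the paths, so
  it is left implicit here. The host is complete, so only its vertex set \<open>W\<close> matters; making it
  a parameter lets an embedding be asked to avoid prescribed vertices.\<close>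

definition divisible_embedding ::
  "nat \<Rightarrow> ('b set \<Rightarrow> int) \<Rightarrow> 'a ugraph \<Rightarrow> 'b set \<Rightarrow> ('a \<Rightarrow> 'b) \<Rightarrow> ('a set \<Rightarrow> 'b list) \<Rightarrow> bool" where
  "divisible_embedding q \<omega> H W \<phi> P \<longleftrightarrow>
     inj_on \<phi> (gverts H) \<and> \<phi> ` gverts H \<subseteq> W \<and>
     (\<forall>e\<in>gedges H. distinct (P e) \<and> length (P e) \<ge> 2 \<and> set (P e) \<subseteq> W \<and>
        {hd (P e), last (P e)} = \<phi> ` e \<and> path_weight q \<omega> (P e) = 0 \<and>
        internal_verts (P e) \<inter> \<phi> ` gverts H = {}) \<and>
     (\<forall>e\<in>gedges H. \<forall>e'\<in>gedges H. e \<noteq> e' \<longrightarrow>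
        internal_verts (P e) \<inter> internal_verts (P e') = {})"

lemma internal_verts_Cons_snoc [simp]: "internal_verts (x # p @ [y]) = set p"
  by (simp add: internal_verts_def)

lemma length_ge_2E:
  assumes "length p \<ge> 2"
  obtains x xs y where "p = x # xs @ [y]"
proof -
  obtain x p' where "p = x # p'" using assms by (cases p) auto
  moreover obtain xs y where "p' = xs @ [y]"
    using assms calculation by (cases p' rule: rev_cases) auto
  ultimately show thesis using that by blast
qed

lemma divisible_embedding_imp_subdivision:
  assumes H: "simple_graph H" and emb: "divisible_embedding q \<omega> H {..<f} \<phi> P"
  shows "has_divisible_subdivision q H (complete_graph f) \<omega>"
proof -
  define S where "S = \<lparr>gverts = \<phi> ` gverts H \<union> (\<Union>e\<in>gedges H. internal_verts (P e)),
    gedges = (\<Union>e\<in>gedges H. set (path_edges (P e)))\<rparr>"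
  have P: "distinct (P e)" "length (P e) \<ge> 2" "set (P e) \<subseteq> {..<f}"
      "{hd (P e), last (P e)} = \<phi> ` e" if "e \<in> gedges H" for e
    using emb that unfolding divisible_embedding_def by auto
  have verts: "set (P e) = \<phi> ` e \<union> internal_verts (P e)" if e: "e \<in> gedges H" for e
  proof -
    obtain x xs y where "P e = x # xs @ [y]" using P(2)[OF e] by (rule length_ge_2E)
    then show ?thesis using P(4)[OF e] by auto
  qed
  have PS: "set (P e) \<subseteq> gverts S" if e: "e \<in> gedges H" for e
    using verts[OF e] H e unfolding S_def simple_graph_def by auto
  have Sf: "gverts S \<subseteq> {..<f}"
  proof -
    have "internal_verts (P e) \<subseteq> {..<f}" if "e \<in> gedges H" for e
      using verts[OF that] P(3)[OF that] by auto
    then show ?thesis using emb unfolding S_def divisible_embedding_def by auto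
  qed
  have edges: "e' \<subseteq> gverts S \<and> card e' = 2" if e': "e' \<in> gedges S" for e'
  proof -
    obtain e where "e \<in> gedges H" "e' \<in> set (path_edges (P e))" using e' unfolding S_def by auto
    then show ?thesis using path_edges_distinct[of "P e" e'] P(1) PS by blast
  qed
  have "subgraph S (complete_graph f)"
    using Sf edges finite_subset[OF Sf] unfolding subgraph_def simple_graph_def complete_graph_def
    by auto
  moreover have "is_path S (P e)" if "e \<in> gedges H" for e
    using P[OF that] PS[OF that] that unfolding is_path_def by (auto simp: S_def)
  then have "subdivision_via H S \<phi> P"
    using emb unfolding subdivision_via_def divisible_embedding_def by (simp add: S_def)
  moreover have "\<forall>e\<in>gedges H. path_weight q \<omega> (P e) = 0"
    using emb unfolding divisible_embedding_def by simp
  ultimately show ?thesis unfolding has_divisible_subdivision_def by blast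
qed

text \<open>The new path starts at the image \<open>y\<close> of the leaf and ends at the branch vertex it is
  attached to. As it runs outside \<open>W\<close> up to that last vertex, it is disjoint from all
  existing paths.\<close>

lemma divisible_embedding_add_leaf:
  assumes H: "simple_graph H" and u: "u \<in> gverts H" and l: "l \<notin> gverts H"
    and emb: "divisible_embedding q \<omega> H W \<phi> P"
    and p: "distinct (y # zs @ [\<phi> u])" "set (y # zs) \<inter> W = {}"
      "path_weight q \<omega> (y # zs @ [\<phi> u]) = 0"
  shows "divisible_embedding q \<omega>
    \<lparr>gverts = insert l (gverts H), gedges = insert {u, l} (gedges H)\<rparr>
    (W \<union> set (y # zs)) (\<phi>(l := y)) (P({u, l} := y # zs @ [\<phi> u]))"
proof -
  have W: "\<phi> ` gverts H \<subseteq> W" using emb unfolding divisible_embedding_def by auto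
  have e_H: "e \<subseteq> gverts H" if "e \<in> gedges H" for e using H that unfolding simple_graph_def by auto
  then have e_ne: "e \<noteq> {u, l}" "l \<notin> e" if "e \<in> gedges H" for e using l that by auto
  have \<phi>_e: "(\<phi>(l := y)) ` A = \<phi> ` A" if "l \<notin> A" for A using that by auto
  have int_W: "internal_verts (P e) \<subseteq> W" if "e \<in> gedges H" for e
    using emb that unfolding divisible_embedding_def internal_verts_def
    by (metis in_set_butlastD list.set_sel(2) list.sel(2) subset_iff)
  have "y \<notin> W" "set zs \<inter> W = {}" using p by auto
  moreover have "u \<noteq> l" using u l by auto
  moreover have "y \<notin> internal_verts (P e)" "set zs \<inter> internal_verts (P e) = {}"
    if "e \<in> gedges H" for e
    using int_W[OF that] calculation by auto
  moreover have "set zs \<inter> \<phi> ` gverts H = {}" "y \<notin> \<phi> ` gverts H" using W calculation by auto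
  moreover have "\<phi> x \<notin> internal_verts (P e)" if "e \<in> gedges H" "x \<in> gverts H" for e x
    using emb that unfolding divisible_embedding_def by blast
  ultimately show ?thesis
    using emb u l p W e_ne unfolding divisible_embedding_def
    by (auto simp: \<phi>_e inj_on_fun_updI Int_commute)
qed

section \<open>The upper bound\<close>

text \<open>Each entry is picked after the earlier ones have been deleted. \<open>N\<close> vertices suffice
  for one choice, and the last of the \<open>k + 1\<close> choices is made when only \<open>k\<close> vertices are
  gone, so \<open>N + k\<close> suffice for all.\<close>

lemma exists_greedy_sequence:
  assumes "\<And>W. W \<subseteq> V \<Longrightarrow> card W \<ge> N \<Longrightarrow> \<exists>x\<in>W. Q W x"
    and "finite V" and "card V \<ge> N + k"
  shows "\<exists>xs. length xs = Suc k \<and> distinct xs \<and> set xs \<subseteq> V \<and>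
    (\<forall>j\<le>k. Q (V - set (take j xs)) (xs ! j))"
  using assms
proof (induction k arbitrary: V)
  case 0
  obtain x where "x \<in> V" "Q V x" using 0(1)[of V] 0(3) by auto
  then show ?case by (intro exI[of _ "[x]"]) auto
next
  case (Suc k)
  obtain x where x: "x \<in> V" "Q V x" using Suc.prems(1)[of V] Suc.prems(3) by auto
  have V': "\<exists>x\<in>W. Q W x" if "W \<subseteq> V - {x}" "card W \<ge> N" for W
    using Suc.prems(1)[of W] that by blast
  have "card (V - {x}) \<ge> N + k" using Suc.prems(2,3) x by simp
  then obtain xs where xs: "length xs = Suc k" "distinct xs" "set xs \<subseteq> V - {x}"
      "\<forall>j\<le>k. Q (V - {x} - set (take j xs)) (xs ! j)"
    using Suc.IH[OF V'] Suc.prems(2) by blast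
  have "Q (V - set (take j (x # xs))) ((x # xs) ! j)" if "j \<le> Suc k" for j
  proof (cases j)
    case (Suc i)
    have "V - insert x (set (take i xs)) = V - {x} - set (take i xs)" by auto
    then show ?thesis using Suc xs(4) that by simp
  qed (use x in simp)
  then show ?case using xs x by (intro exI[of _ "x # xs"]) auto
qed

text \<open>The nonempty prefixes of \<open>xs\<close> are \<open>q + 1\<close> paths with weights among \<open>q\<close> residues, so two
  of them have the same weight, and the part by which they differ has weight \<open>0\<close>.\<close>

lemma zero_weight_segment:
  assumes "length xs = Suc q" and "q > 0"
  obtains as y zs z bs where "xs = as @ y # zs @ z # bs" "path_weight q \<omega> (y # zs @ [z]) = 0"
proof -
  define s where "s j = path_weight q \<omega> (take (Suc j) xs)" for j
  have "s ` {..q} \<subseteq> {0..<int q}" using assms unfolding s_def path_weight_def by auto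
  then have "card (s ` {..q}) \<le> q" using card_mono[of "{0..<int q}" "s ` {..q}"] by simp
  then have "\<not> inj_on s {..q}" by (intro pigeonhole) simp
  then obtain i j where ij: "i < j" "j \<le> q" "s i = s j"
    unfolding inj_on_def by (metis atMost_iff linorder_neq_iff)
  define as y zs z where defs: "as = take i xs" "y = xs ! i"
    "zs = take (j - Suc i) (drop (Suc i) xs)" "z = xs ! j"
  have ti: "take (Suc i) xs = as @ [y]"
    using ij assms by (simp add: defs take_Suc_conv_app_nth)
  have "take j xs = take (Suc i) xs @ zs"
    using ij take_add[of "Suc i" "j - Suc i" xs] by (simp add: defs)
  then have tj: "take (Suc j) xs = as @ y # zs @ [z]"
    using ij assms ti by (simp add: defs(4) take_Suc_conv_app_nth)
  have "xs = as @ y # zs @ z # drop (Suc j) xs"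
    using append_take_drop_id[of "Suc j" xs] unfolding tj by simp
  moreover have "path_weight q \<omega> (y # zs @ [z]) = 0"
  proof -
    let ?w = "\<lambda>p. \<Sum>e\<leftarrow>path_edges p. \<omega> e"
    have "?w (as @ y # zs @ [z]) = ?w (as @ [y]) + ?w (y # zs @ [z])"
      using path_edges_append[of as y "zs @ [z]"] by simp
    then have "(?w (as @ [y]) + ?w (y # zs @ [z])) mod int q = ?w (as @ [y]) mod int q"
      using ij(3) unfolding s_def ti tj path_weight_def by simp
    then have "int q dvd ?w (y # zs @ [z])"
      by (metis add_diff_cancel_left' mod_eq_dvd_iff)
    then show ?thesis unfolding path_weight_def by simp
  qed
  ultimately show thesis using that by blast
qed

lemma divisible_embedding_mono:
  "divisible_embedding q \<omega> H W \<phi> P \<Longrightarrow> W \<subseteq> V \<Longrightarrow> divisible_embedding q \<omega> H V \<phi> P"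
  unfolding divisible_embedding_def by (meson subset_trans)

lemma tree_has_divisible_embedding:
  assumes "tree T" and "q > 0" and "finite V" and "card V \<ge> (card (gverts T) - 1) * q + 1"
  shows "\<exists>\<phi> P. divisible_embedding q \<omega> T V \<phi> P"
  using assms(1,3,4)
proof (induction T arbitrary: V rule: tree_induct)
  case (single v)
  have "V \<noteq> {}" using single.prems(2) by (intro notI) simp
  then obtain x where "x \<in> V" by blast
  then show ?case by (intro exI[of _ "\<lambda>_. x"]) (auto simp: divisible_embedding_def)
next
  case (leaf T u l)
  let ?T = "\<lparr>gverts = insert l (gverts T), gedges = insert {u, l} (gedges T)\<rparr>"
  define N where "N = (card (gverts T) - 1) * q + 1"
  \<comment> \<open>\<open>x\<close> can play the part of the attaching vertex \<open>u\<close> in an embedding inside \<open>W\<close>.\<close>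
  define Q where "Q W x \<longleftrightarrow> (\<exists>\<phi> P. divisible_embedding q \<omega> T W \<phi> P \<and> \<phi> u = x)" for W x
  have T: "simple_graph T" "finite (gverts T)"
    using leaf.hyps(1) unfolding tree_def simple_graph_def by blast+
  have step: "\<exists>x\<in>W. Q W x" if W: "W \<subseteq> V" "card W \<ge> N" for W
  proof -
    have "finite W" using W(1) leaf.prems(1) by (rule finite_subset)
    then obtain \<phi> P where "divisible_embedding q \<omega> T W \<phi> P"
      using leaf.IH W(2) unfolding N_def by blast
    moreover from this have "\<phi> u \<in> W"
      using leaf.hyps(2) unfolding divisible_embedding_def by blast
    ultimately show ?thesis unfolding Q_def by blast
  qed
  have "card (gverts T) \<noteq> 0" using T(2) leaf.hyps(2) by auto
  then have "card (gverts T) * q = (card (gverts T) - 1) * q + q"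
    by (cases "card (gverts T)") auto
  moreover have "card V \<ge> card (gverts T) * q + 1"
    using leaf.prems(2) leaf.hyps(3) T(2) by simp
  ultimately have "card V \<ge> N + q" unfolding N_def by linarith
  from exists_greedy_sequence[of V N Q, OF step leaf.prems(1) this]
  obtain xs where xs: "length xs = Suc q" "distinct xs" "set xs \<subseteq> V"
      "\<forall>j\<le>q. Q (V - set (take j xs)) (xs ! j)" by blast
  obtain as y zs z bs where eq: "xs = as @ y # zs @ z # bs"
    and zero: "path_weight q \<omega> (y # zs @ [z]) = 0"
    using zero_weight_segment[OF xs(1) \<open>q > 0\<close>] by metis
  define j where "j = length (as @ y # zs)"
  have "take j xs = as @ y # zs" "xs ! j = z" "j \<le> q"
    using eq xs(1) by (auto simp: j_def nth_append)
  \<comment> \<open>Of the two ends of the segment, the later one \<open>z\<close> has to carry \<open>u\<close>: its embedding avoids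
    the rest of the segment, whereas the one belonging to \<open>y\<close> may run through it.\<close>
  then obtain \<phi> P where emb: "divisible_embedding q \<omega> T (V - set (as @ y # zs)) \<phi> P"
    and \<phi>: "\<phi> u = z"
    using xs(4)[rule_format, of j] unfolding Q_def by auto
  have "divisible_embedding q \<omega> ?T (V - set (as @ y # zs) \<union> set (y # zs))
      (\<phi>(l := y)) (P({u, l} := y # zs @ [\<phi> u]))"
    using xs(2) zero unfolding eq
    by (intro divisible_embedding_add_leaf[OF T(1) leaf.hyps(2,3) emb]) (auto simp: \<phi>)
  then have "divisible_embedding q \<omega> ?T V (\<phi>(l := y)) (P({u, l} := y # zs @ [\<phi> u]))"
    by (rule divisible_embedding_mono) (use xs(3) eq in auto)
  then show ?case by blast
qed

section \<open>The lower bound\<close>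

text \<open>With unit weights the weight of a path is its length modulo \<open>q\<close>, so every subdivision path
  has length at least \<open>q\<close>.\<close>

lemma unit_weight_subdivision_card:
  assumes H: "finite (gverts H)" "finite (gedges H)" and q: "q \<ge> 1"
    and sub: "has_divisible_subdivision q H (complete_graph f) (\<lambda>_. 1)"
  shows "f \<ge> card (gverts H) + card (gedges H) * (q - 1)"
proof -
  obtain S \<phi> P where S: "subgraph S (complete_graph f)" and via: "subdivision_via H S \<phi> P"
    and zero: "\<And>e. e \<in> gedges H \<Longrightarrow> path_weight q (\<lambda>_. 1) (P e) = 0"
    using sub unfolding has_divisible_subdivision_def by blast
  let ?I = "\<Union>e\<in>gedges H. internal_verts (P e)"
  have long: "card (internal_verts (P e)) \<ge> q - 1" if e: "e \<in> gedges H" for e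
  proof -
    have P: "distinct (P e)" "length (P e) \<ge> 2"
      using via e unfolding subdivision_via_def is_path_def by auto
    obtain x xs y where eq: "P e = x # xs @ [y]" using P(2) by (rule length_ge_2E)
    have "int q dvd int (Suc (length xs))"
      using zero[OF e] unfolding path_weight_def eq
      by (simp add: sum_list_triv length_path_edges mod_eq_0_iff_dvd add.commute)
    then have "q \<le> Suc (length xs)" by (metis dvd_imp_le int_dvd_int_iff zero_less_Suc)
    then show ?thesis using P(1) unfolding eq by (simp add: distinct_card)
  qed
  have "card (gedges H) * (q - 1) \<le> (\<Sum>e\<in>gedges H. card (internal_verts (P e)))"
    using sum_mono[of "gedges H" "\<lambda>_. q - 1"] long by simp
  also have "\<dots> = card ?I"
    using H via unfolding subdivision_via_def
    by (intro card_UN_disjoint[symmetric]) (auto simp: internal_verts_def)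
  finally have I: "card (gedges H) * (q - 1) \<le> card ?I" .
  have "card (gverts H) + card ?I = card (\<phi> ` gverts H) + card ?I"
    using via unfolding subdivision_via_def by (simp add: card_image)
  also have "\<dots> = card (gverts S)"
  proof -
    have "gverts S = \<phi> ` gverts H \<union> ?I" using via unfolding subdivision_via_def by simp
    moreover have "\<phi> ` gverts H \<inter> ?I = {}"
      unfolding Int_UN_distrib using via unfolding subdivision_via_def by (simp add: Int_commute)
    moreover have "finite ?I" using H by (auto simp: internal_verts_def)
    ultimately show ?thesis using H by (simp add: card_Un_disjoint)
  qed
  also have "\<dots> \<le> f"
    using S card_mono[of "{..<f}" "gverts S"] unfolding subgraph_def complete_graph_def by simp
  finally show ?thesis using I by linarith
qed

theorem theorem1p5:
  fixes T :: "'a ugraph" and n q :: nat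
  assumes "tree T" and "card (gverts T) = n" and "q \<ge> 2"
  shows "s_number q T = enat (n * q - q + 1)"
proof -
  let ?m = "n * q - q + 1"
  let ?F = "{f. \<forall>\<omega>. Zq_weighting q (complete_graph f) \<omega> \<longrightarrow>
    has_divisible_subdivision q T (complete_graph f) \<omega>}"
  have T: "simple_graph T" "finite (gverts T)"
    using assms(1) unfolding tree_def simple_graph_def by auto
  have E: "finite (gedges T)" "n = card (gedges T) + 1"
    using tree_finite_edges_card[OF assms(1)] assms(2) by auto
  have "?m \<in> ?F"
  proof (intro CollectI allI impI)
    fix \<omega> :: "nat set \<Rightarrow> int"
    have "\<exists>\<phi> P. divisible_embedding q \<omega> T {..<?m} \<phi> P"
      using assms by (intro tree_has_divisible_embedding) (auto simp: diff_mult_distrib)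
    then show "has_divisible_subdivision q T (complete_graph ?m) \<omega>"
      using divisible_embedding_imp_subdivision[OF T(1)] by blast
  qed
  moreover have "?m \<le> f" if "f \<in> ?F" for f
  proof -
    have "Zq_weighting q (complete_graph f) (\<lambda>_. 1)"
      using assms(3) unfolding Zq_weighting_def by auto
    then have "has_divisible_subdivision q T (complete_graph f) (\<lambda>_. 1)" using that by blast
    then have "f \<ge> n + card (gedges T) * (q - 1)"
      using unit_weight_subdivision_card[OF T(2) E(1)] assms by simp
    then show ?thesis using E(2) assms(3) by (cases q) (simp_all add: algebra_simps)
  qed
  ultimately show ?thesis
    unfolding s_number_def by (intro antisym Inf_lower Inf_greatest) auto
qed

end
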